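(* Let $\mathcal{X},\mathcal{X}',\mathcal{Y},\mathcal{Y}'$ be four finite non-empty sets. Let $W$ be a channel from $\mathcal{X}$ to $\mathcal{Y}$ and let $W'$ be a channel from $\mathcal{X}'$ to $\mathcal{Y}'$. The following conditions are equivalent: (a) $W'$ contains $W$. (b) For every two finite non-empty sets $\mathcal{U}$ and $\mathcal{V}$, and every payoff function $l:\mathcal{U}\times\mathcal{V}\to\mathbb{R}$, we have $\$_{\mathrm{ach}}(\mathcal{U},\mathcal{X},\mathcal{Y},\mathcal{V},l,W)\subset \$_{\mathrm{ach}}(\mathcal{U},\mathcal{X}',\mathcal{Y}',\mathcal{V},l,W')$. (c) For every two finite non-empty sets $\mathcal{U}$ and $\mathcal{V}$, and every payoff function $l:\mathcal{U}\times\mathcal{V}\to\mathbb{R}$, we have $\$_{\mathrm{opt}}(\mathcal{U},\mathcal{X},\mathcal{Y},\mathcal{V},l,W)\leq \$_{\mathrm{opt}}(\mathcal{U},\mathcal{X}',\mathcal{Y}',\mathcal{V},l,W')$. (d) For every two finite non-empty sets $\mathcal{U}$ and $\mathcal{V}$, and every normalized and positive payoff function $l\in\Delta_{\mathcal{U}\times\mathcal{V}}$, we have $\$_{\mathrm{ach}}(\mathcal{U},\mathcal{X},\mathcal{Y},\mathcal{V},l,W)\subset \$_{\mathrm{ach}}(\mathcal{U},\mathcal{X}',\mathcal{Y}',\mathcal{V},l,W')$. (e) For every two finite non-empty sets $\mathcal{U}$ and $\mathcal{V}$, and every normalized and positive payoff function $l\in\Delta_{\mathcal{U}\times\mathcal{V}}$,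 we have $\$_{\mathrm{opt}}(\mathcal{U},\mathcal{X},\mathcal{Y},\mathcal{V},l,W)\leq \$_{\mathrm{opt}}(\mathcal{U},\mathcal{X}',\mathcal{Y}',\mathcal{V},l,W')$.
   Context: For finite sets $\mathcal{A},\mathcal{B}$, $\mathrm{DMC}_{\mathcal{A},\mathcal{B}}$ is the set of channels from $\mathcal{A}$ to $\mathcal{B}$, i.e. families $W=(W(b|a))_{a\in\mathcal{A},b\in\mathcal{B}}$ of non-negative reals with $\sum_{b}W(b|a)=1$ for every $a$. $\Delta_{\mathcal{A}}$ is the set of probability distributions on $\mathcal{A}$, and $[n]=\{1,\dots,n\}$. Composition of $W\in\mathrm{DMC}_{\mathcal{A},\mathcal{B}}$ and $V\in\mathrm{DMC}_{\mathcal{B},\mathcal{C}}$ is $(V\circ W)(c|a)=\sum_{b}V(c|b)W(b|a)$. A channel $W'\in\mathrm{DMC}_{\mathcal{X}',\mathcal{Y}'}$ contains $W\in\mathrm{DMC}_{\mathcal{X},\mathcal{Y}}$ if there exist $n\geq 1$, $\alpha\in\Delta_{[n]}$, $R_i\in\mathrm{DMC}_{\mathcal{X},\mathcal{X}'}$ and $T_i\in\mathrm{DMC}_{\mathcal{Y}',\mathcal{Y}}$ ($1\le i\le n$) such that $W=\sum_{i=1}^n\alpha(i)\,T_i\circ W'\circ R_i$. A blind randomized in the middle (BRM) game is a 6-tuple $\mathcal{G}=(\mathcal{U},\mathcal{X},\mathcal{Y},\mathcal{V},l,W)$ with $\mathcal{U},\mathcal{X},\mathcal{Y},\mathcal{V}$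 finite sets, $l:\mathcal{U}\times\mathcal{V}\to\mathbb{R}$ (the payoff function) and $W\in\mathrm{DMC}_{\mathcal{X},\mathcal{Y}}$. A strategy is a tuple $S=(n,\alpha,(f_i)_{1\le i\le n},(g_i)_{1\le i\le n})$ with $n\ge 1$, $\alpha\in\Delta_{[n]}$, functions $f_i:\mathcal{U}\to\mathcal{X}$ and $g_i:\mathcal{Y}\to\mathcal{V}$; $\mathcal{S}_{\mathcal{U},\mathcal{X},\mathcal{Y},\mathcal{V}}$ is the set of strategies. The payoff of $S$ for $u\in\mathcal{U}$ is $$\$(u,S,\mathcal{G})=\sum_{i=1}^{n}\alpha(i)\sum_{y\in\mathcal{Y}}W(y|f_i(u))\,l(u,g_i(y)).$$ The achievable payoff region is $\$_{\mathrm{ach}}(\mathcal{G})=\{(\$(u,S,\mathcal{G}))_{u\in\mathcal{U}}: S\in\mathcal{S}_{\mathcal{U},\mathcal{X},\mathcal{Y},\mathcal{V}}\}\subset\mathbb{R}^{\mathcal{U}}$, and the optimal average payoff is $\$_{\mathrm{opt}}(\mathcal{G})=\sup_{S\in\mathcal{S}_{\mathcal{U},\mathcal{X},\mathcal{Y},\mathcal{V}}}\frac{1}{|\mathcal{U}|}\sum_{u\in\mathcal{U}}\$(u,S,\mathcal{G})$. A payoff function $l$ is normalized and positive if $l\ge 0$ and $\sum_{u,v}l(u,v)=1$, i.e. $l\in\Delta_{\mathcal{U}\times\mathcal{V}}$. *)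

theory Defs
  imports Complex_Main "HOL-Library.FuncSet" "HOL-Library.Infinite_Typeclass"
begin

text \<open>
  Finite sets are explicit carriers inside arbitrary types. Families and functions indexed by
  a carrier are total functions of which only the values on the carrier matter; accordingly,
  equality of channels is required on the carriers only.

  HOL cannot quantify over types inside a formula, so ``for all finite sets \<open>U\<close>'' is expressed by
  quantifying over the finite subsets of an arbitrary type of class \<^class>\<open>infinite\<close>, which contains
  a copy of every finite set.
\<close>

definition prob_dists :: "'a set \<Rightarrow> ('a \<Rightarrow> real) set" where
  "prob_dists A = {p. (\<forall>a\<in>A. 0 \<le> p a) \<and> (\<Sum>a\<in>A. p a) = 1}"

text \<open>\<open>W a b\<close> stands for the transition probability $W(b|a)$.\<close>

definition DMC :: "'a set \<Rightarrow> 'b set \<Rightarrow> ('a \<Rightarrow> 'b \<Rightarrow> real) set" where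
  "DMC A B = {W. \<forall>a\<in>A. (\<forall>b\<in>B. 0 \<le> W a b) \<and> (\<Sum>b\<in>B. W a b) = 1}"

text \<open>\<open>channel_comp B V W\<close> is $V \circ W$, where \<open>B\<close> is the intermediate alphabet.\<close>

definition channel_comp ::
    "'b set \<Rightarrow> ('b \<Rightarrow> 'c \<Rightarrow> real) \<Rightarrow> ('a \<Rightarrow> 'b \<Rightarrow> real) \<Rightarrow> 'a \<Rightarrow> 'c \<Rightarrow> real" where
  "channel_comp B V W = (\<lambda>a c. \<Sum>b\<in>B. V b c * W a b)"

text \<open>\<open>channel_contains X' Y' W' X Y W\<close>: the channel \<open>W'\<close> from \<open>X'\<close> to \<open>Y'\<close> contains
  the channel \<open>W\<close> from \<open>X\<close> to \<open>Y\<close>.\<close>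

definition channel_contains ::
    "'x2 set \<Rightarrow> 'y2 set \<Rightarrow> ('x2 \<Rightarrow> 'y2 \<Rightarrow> real) \<Rightarrow> 'x set \<Rightarrow> 'y set \<Rightarrow> ('x \<Rightarrow> 'y \<Rightarrow> real) \<Rightarrow> bool" where
  "channel_contains X' Y' W' X Y W \<longleftrightarrow>
    (\<exists>(n::nat) \<alpha> R T. n \<ge> 1 \<and> \<alpha> \<in> prob_dists {1..n} \<and>
      (\<forall>i\<in>{1..n}. R i \<in> DMC X X' \<and> T i \<in> DMC Y' Y) \<and>
      (\<forall>x\<in>X. \<forall>y\<in>Y. W x y =
        (\<Sum>i=1..n. \<alpha> i * channel_comp Y' (T i) (channel_comp X' W' (R i)) x y)))"

text \<open>A BRM game is the tuple \<open>(U, X, Y, V, l, W)\<close>, a strategy the tuple \<open>(n, \<alpha>, f, g)\<close>.\<close>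

type_synonym ('u, 'x, 'y, 'v) brm_game =
  "'u set \<times> 'x set \<times> 'y set \<times> 'v set \<times> ('u \<times> 'v \<Rightarrow> real) \<times> ('x \<Rightarrow> 'y \<Rightarrow> real)"

type_synonym ('u, 'x, 'y, 'v) brm_strategy =
  "nat \<times> (nat \<Rightarrow> real) \<times> (nat \<Rightarrow> 'u \<Rightarrow> 'x) \<times> (nat \<Rightarrow> 'y \<Rightarrow> 'v)"

definition brm_strategies ::
    "'u set \<Rightarrow> 'x set \<Rightarrow> 'y set \<Rightarrow> 'v set \<Rightarrow> ('u, 'x, 'y, 'v) brm_strategy set" where
  "brm_strategies U X Y V =
    {(n, \<alpha>, f, g). n \<ge> 1 \<and> \<alpha> \<in> prob_dists {1..n} \<and>
      (\<forall>i\<in>{1..n}. f i \<in> U \<rightarrow> X \<and> g i \<in> Y \<rightarrow> V)}"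

fun payoff :: "'u \<Rightarrow> ('u, 'x, 'y, 'v) brm_strategy \<Rightarrow> ('u, 'x, 'y, 'v) brm_game \<Rightarrow> real" where
  "payoff u (n, \<alpha>, f, g) (U, X, Y, V, l, W) =
    (\<Sum>i=1..n. \<alpha> i * (\<Sum>y\<in>Y. W (f i u) y * l (u, g i y)))"

text \<open>Payoff vectors are restricted to \<open>U\<close> (via \<^const>\<open>restrict\<close>), so that two of them are
  equal iff they agree on \<open>U\<close>.\<close>

fun payoff_ach :: "('u, 'x, 'y, 'v) brm_game \<Rightarrow> ('u \<Rightarrow> real) set" where
  "payoff_ach (U, X, Y, V, l, W) =
    {(\<lambda>u\<in>U. payoff u S (U, X, Y, V, l, W)) | S. S \<in> brm_strategies U X Y V}"

text \<open>For finite non-empty carriers and a channel \<open>W\<close> the supremum ranges over a non-empty bounded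
  set of reals.\<close>

fun payoff_opt :: "('u, 'x, 'y, 'v) brm_game \<Rightarrow> real" where
  "payoff_opt (U, X, Y, V, l, W) =
    (SUP S\<in>brm_strategies U X Y V.
      1 / real (card U) * (\<Sum>u\<in>U. payoff u S (U, X, Y, V, l, W)))"

end

theory Submission
  imports Defs "HOL-Analysis.Function_Topology"
begin

text \<open>
  A channel is a mixture of deterministic maps (choose the images of the inputs independently), so
  \<open>W'\<close> contains \<open>W\<close> iff \<open>W\<close> lies in the convex hull of the finitely many channels obtained from \<open>W'\<close>
  by a deterministic encoder \<open>r\<close> and a deterministic decoder \<open>t\<close>. If it does, a strategy for \<open>W\<close> is
  simulated by composing it with random \<open>(r, t)\<close>, which gives all inclusions of payoff regions. If it
  does not, a separating linear functional on \<open>X \<times> Y\<close> is a payoff function for which the identity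
  strategy on \<open>W\<close> beats every strategy on \<open>W'\<close>; since rows of channels sum to 1, shifting and scaling
  the functional preserves the separation and makes it normalized and positive.
\<close>

section \<open>Separation of a point from a finitely generated convex hull\<close>

text \<open>Values outside \<open>K\<close> are unconstrained in \<open>prob_dists K\<close>, so in
  general that set is closed but not compact. Pinning them to 0 confines it to a product of compact
  sets, which is compact by Tychonoff.\<close>

lemma compact_prob_dists:
  fixes K :: "'k set"
  assumes "finite K"
  shows "compact (prob_dists K \<inter> (\<Pi>\<^sub>E k\<in>UNIV. if k \<in> K then {0..1} else {0}))"
proof -
  have "compactin (product_topology (\<lambda>_. euclidean) UNIV)
      (\<Pi>\<^sub>E k\<in>UNIV. if k \<in> K then {0..1::real} else {0})"
    by (subst compactin_PiE) auto
  then have "compact (\<Pi>\<^sub>E k\<in>UNIV. if k \<in> K then {0..1::real} else {0})"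
    by (simp add: euclidean_product_topology)
  moreover have "closed (prob_dists K)"
    unfolding prob_dists_def Ball_def
    by (intro closed_Collect_conj closed_Collect_all closed_Collect_imp closed_Collect_le
        closed_Collect_eq continuous_intros open_Collect_const continuous_on_product_coordinates)
  ultimately show ?thesis
    by (rule closed_Int_compact[rotated])
qed

lemma prob_dists_le_1:
  assumes "finite K" "p \<in> prob_dists K" "k \<in> K"
  shows "p k \<le> 1"
  using assms member_le_sum[of k K p] by (auto simp: prob_dists_def)

text \<open>The separating functional is \<open>w - q\<close> for the point \<open>q\<close> of the hull nearest to \<open>w\<close>. Compactness
  is taken in the product topology on functions, as \<open>'a\<close> and \<open>'k\<close> need not be finite types.\<close>

lemma convex_separation:
  fixes c :: "'k \<Rightarrow> 'a \<Rightarrow> real" and w :: "'a \<Rightarrow> real"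
  assumes K: "finite K" "K \<noteq> {}" and A: "finite A"
    and not: "\<not> (\<exists>p\<in>prob_dists K. \<forall>a\<in>A. w a = (\<Sum>k\<in>K. p k * c k a))"
  shows "\<exists>l. \<forall>k\<in>K. (\<Sum>a\<in>A. l a * c k a) < (\<Sum>a\<in>A. l a * w a)"
proof -
  define S where "S = prob_dists K \<inter> (\<Pi>\<^sub>E k\<in>UNIV. if k \<in> K then {0..1} else {0})"
  define F where "F p = (\<Sum>a\<in>A. (w a - (\<Sum>k\<in>K. p k * c k a))\<^sup>2)" for p
  \<comment> \<open>Zeroing the values outside \<open>K\<close> leaves all sums over
    \<open>K\<close> unchanged, so a minimum of \<open>F\<close> over \<open>S\<close> is a minimum
    over all of \<open>prob_dists K\<close>.\<close>
  have SI: "(\<lambda>k. if k \<in> K then p k else 0) \<in> S" if "p \<in> prob_dists K" for p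
    using that prob_dists_le_1[OF K(1) that] K(1) by (auto simp: S_def prob_dists_def)
  obtain k0 where "k0 \<in> K" using K(2) by auto
  then have "(\<lambda>k. of_bool (k = k0)) \<in> prob_dists K"
    using K(1) by (auto simp: prob_dists_def of_bool_def)
  then have "S \<noteq> {}" using SI by blast
  moreover have "compact S" unfolding S_def by (rule compact_prob_dists[OF K(1)])
  moreover have "continuous_on S F"
    unfolding F_def
    by (intro continuous_intros continuous_on_subset[OF continuous_on_product_coordinates]) auto
  ultimately obtain p where p: "p \<in> S" "\<And>p'. p' \<in> S \<Longrightarrow> F p \<le> F p'"
    using continuous_attains_inf by metis
  have pP: "p \<in> prob_dists K" using p(1) by (simp add: S_def)
  have min: "F p \<le> F p'" if "p' \<in> prob_dists K" for p'
    using p(2)[OF SI[OF that]] by (simp add: F_def cong: sum.cong)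
  define q where "q a = (\<Sum>k\<in>K. p k * c k a)" for a
  define d where "d a = w a - q a" for a
  obtain a0 where "a0 \<in> A" "d a0 \<noteq> 0"
    using not pP by (auto simp: d_def q_def)
  then have pos: "0 < (\<Sum>a\<in>A. d a * d a)"
    using A by (intro sum_pos2[of A a0]) (auto simp: zero_less_mult_iff linorder_neq_iff)
  have "(\<Sum>a\<in>A. d a * c k a) < (\<Sum>a\<in>A. d a * w a)" if k: "k \<in> K" for k
  proof -
    \<comment> \<open>Moving \<open>p\<close> towards the vertex \<open>k\<close> by a fraction
      \<open>t\<close> turns \<open>F p\<close> into \<open>F p - 2 * t * B + t\<^sup>2 * N\<close>.
      Minimality of \<open>F p\<close> bounds the linear term by the quadratic one.\<close>
    define B where "B = (\<Sum>a\<in>A. d a * (c k a - q a))"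
    define N where "N = (\<Sum>a\<in>A. (c k a - q a)\<^sup>2)"
    have N: "0 \<le> N" by (auto simp: N_def intro: sum_nonneg)
    have le: "2 * t * B \<le> t\<^sup>2 * N" if t: "0 \<le> t" "t \<le> 1" for t
    proof -
      define p' where "p' j = (1 - t) * p j + t * of_bool (j = k)" for j
      have "(\<Sum>j\<in>K. p' j) = (1 - t) * (\<Sum>j\<in>K. p j) + t"
        using k K(1) by (simp add: p'_def sum.distrib of_bool_def flip: sum_distrib_left)
      with pP t have "p' \<in> prob_dists K"
        by (auto simp: prob_dists_def p'_def)
      then have "F p \<le> F p'" by (rule min)
      moreover have mix: "(\<Sum>j\<in>K. p' j * c j a) = (1 - t) * q a + t * c k a" for a
      proof -
        have "(\<Sum>j\<in>K. p' j * c j a) =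
            (\<Sum>j\<in>K. (1 - t) * (p j * c j a) + (if j = k then t * c j a else 0))"
          by (intro sum.cong) (auto simp: p'_def algebra_simps)
        then show ?thesis
          using k K(1) by (simp add: sum.distrib q_def flip: sum_distrib_left)
      qed
      have "F p' = (\<Sum>a\<in>A. (d a)\<^sup>2 - 2 * t * (d a * (c k a - q a)) + t\<^sup>2 * (c k a - q a)\<^sup>2)"
        unfolding F_def mix d_def
        by (intro sum.cong refl) (simp add: power2_eq_square algebra_simps)
      then have "F p' = F p - 2 * t * B + t\<^sup>2 * N"
        by (simp add: sum.distrib sum_subtractf sum_distrib_left B_def N_def F_def d_def q_def)
      ultimately show ?thesis by simp
    qed
    have "B \<le> 0"
    proof (rule ccontr)
      assume "\<not> B \<le> 0"
      then have B: "B > 0" by simp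
      \<comment> \<open>This step size lies in (0,1] even when \<open>N = 0\<close>, and it gives
        \<open>t * N \<le> B\<close>, against \<open>2 * B \<le> t * N\<close>.\<close>
      define t where "t = B / (N + B)"
      have t: "0 < t" "t \<le> 1" "t * (N + B) = B"
        using B N by (auto simp: t_def)
      have "t * (2 * B) \<le> t * (t * N)"
        using le[of t] t by (simp add: power2_eq_square algebra_simps)
      then have "2 * B \<le> t * N" using t(1) by simp
      moreover have "t * N \<le> B"
        using t B mult_pos_pos[OF t(1) B] unfolding distrib_left by linarith
      ultimately show False using B by simp
    qed
    then have "(\<Sum>a\<in>A. d a * c k a) \<le> (\<Sum>a\<in>A. d a * q a)"
      by (simp add: B_def right_diff_distrib sum_subtractf)
    \<comment> \<open>As \<open>d = w - q\<close>, pairing \<open>d\<close> with \<open>w\<close>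
      exceeds pairing it with \<open>q\<close> by the squared length of \<open>d\<close>, which is
      positive because \<open>w\<close> is outside the hull.\<close>
    also have "\<dots> < (\<Sum>a\<in>A. d a * q a) + (\<Sum>a\<in>A. d a * d a)"
      using pos by simp
    also have "\<dots> = (\<Sum>a\<in>A. d a * w a)"
      unfolding sum.distrib[symmetric] by (intro sum.cong) (auto simp: d_def algebra_simps)
    finally show ?thesis .
  qed
  then show ?thesis by blast
qed

section \<open>Channels as mixtures of deterministic maps\<close>

text \<open>The law of a random map whose values at the points of \<open>A\<close> are drawn
  independently, the value at \<open>x\<close> according to row \<open>x\<close> of
  \<open>R\<close>.\<close>

definition product_dist :: "'a set \<Rightarrow> ('a \<Rightarrow> 'b \<Rightarrow> real) \<Rightarrow> ('a \<Rightarrow> 'b) \<Rightarrow> real" where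
  "product_dist A R r = (\<Prod>x\<in>A. R x (r x))"

lemma product_dist_prob_dists:
  assumes "finite A" "finite B" "R \<in> DMC A B"
  shows "product_dist A R \<in> prob_dists (A \<rightarrow>\<^sub>E B)"
proof -
  have "(\<Sum>r\<in>A \<rightarrow>\<^sub>E B. \<Prod>x\<in>A. R x (r x)) = (\<Prod>x\<in>A. \<Sum>y\<in>B. R x y)"
    using assms(1,2) by (simp add: prod_sum_PiE)
  also have "\<dots> = 1"
    using assms(3) by (simp add: DMC_def)
  moreover have "0 \<le> product_dist A R r" if "r \<in> A \<rightarrow>\<^sub>E B" for r
    unfolding product_dist_def
    using that assms(3) by (intro prod_nonneg) (auto simp: DMC_def PiE_iff)
  ultimately show ?thesis
    by (simp add: prob_dists_def product_dist_def)
qed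

lemma product_dist_marginal:
  assumes "finite A" "finite B" "R \<in> DMC A B" "x \<in> A"
  shows "(\<Sum>r\<in>A \<rightarrow>\<^sub>E B. product_dist A R r * h (r x)) = (\<Sum>y\<in>B. R x y * h y)"
proof -
  \<comment> \<open>Attaching \<open>h\<close> to the coordinate \<open>x\<close> alone keeps the
    summand a product over coordinates, so the sum factorizes; every other factor is a row sum,
    hence 1.\<close>
  let ?g = "\<lambda>z y. R z y * (if z = x then h y else 1)"
  have "(\<Sum>r\<in>A \<rightarrow>\<^sub>E B. product_dist A R r * h (r x)) = (\<Sum>r\<in>A \<rightarrow>\<^sub>E B. \<Prod>z\<in>A. ?g z (r z))"
    using assms(1,4) by (simp add: product_dist_def prod.distrib)
  also have "\<dots> = (\<Prod>z\<in>A. \<Sum>y\<in>B. ?g z y)"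
    using assms(1,2) by (simp add: prod_sum_PiE)
  also have "\<dots> = (\<Prod>z\<in>A. if z = x then \<Sum>y\<in>B. R x y * h y else 1)"
    using assms(3) by (intro prod.cong) (auto simp: DMC_def)
  also have "\<dots> = (\<Sum>y\<in>B. R x y * h y)"
    using assms(1,4) by simp
  finally show ?thesis .
qed

lemma prob_dists_Times:
  assumes "p \<in> prob_dists A" "q \<in> prob_dists B"
  shows "(\<lambda>k. p (fst k) * q (snd k)) \<in> prob_dists (A \<times> B)"
  using assms by (auto simp: prob_dists_def sum.cartesian_product' simp flip: sum_product)

lemma prob_dists_reindex:
  assumes "bij_betw b I K" "p \<in> prob_dists K"
  shows "p \<circ> b \<in> prob_dists I"
  using assms sum.reindex_bij_betw[OF assms(1), of p]
  by (auto simp: prob_dists_def dest: bij_betwE)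

text \<open>Turns mixtures over arbitrary finite index sets into the \<open>{1..n}\<close> form of
  the definitions. \<open>K\<close> cannot be empty, as the weights sum to 1; hence
  \<open>n \<ge> 1\<close>.\<close>

lemma prob_dists_enumeration:
  assumes "finite K" "p \<in> prob_dists K"
  obtains n :: nat and b where "n \<ge> 1" "bij_betw b {1..n} K"
proof -
  obtain b where b: "bij_betw b {1..card K} K"
    using ex_bij_betw_nat_finite_1[OF assms(1)] by auto
  have "K \<noteq> {}" using assms(2) by (auto simp: prob_dists_def)
  then have "card K \<ge> 1" using assms(1) by (simp add: Suc_le_eq card_gt_0_iff)
  with b show ?thesis using that by blast
qed

section \<open>Containment as membership in a convex hull\<close>

text \<open>The composite of \<open>W'\<close> with the deterministic encoder \<open>fst k\<close>
  and the deterministic decoder \<open>snd k\<close>, both regarded as 0-1 channels.\<close>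

definition det_sim ::
    "'y2 set \<Rightarrow> ('x2 \<Rightarrow> 'y2 \<Rightarrow> real) \<Rightarrow> ('x \<Rightarrow> 'x2) \<times> ('y2 \<Rightarrow> 'y) \<Rightarrow> 'x \<Rightarrow> 'y \<Rightarrow> real" where
  "det_sim Y' W' k x y = (\<Sum>y'\<in>Y'. W' (fst k x) y' * of_bool (snd k y' = y))"

text \<open>Change of variables: the output law is the image of a row of \<open>W'\<close> under the
  decoder, so the decoder can be moved into the integrand.\<close>

lemma sum_det_sim:
  assumes "finite Y" "snd k \<in> Y' \<rightarrow> Y"
  shows "(\<Sum>y\<in>Y. det_sim Y' W' k x y * h y) = (\<Sum>y'\<in>Y'. W' (fst k x) y' * h (snd k y'))"
proof -
  have "(\<Sum>y\<in>Y. det_sim Y' W' k x y * h y) =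
      (\<Sum>y'\<in>Y'. \<Sum>y\<in>Y. if y = snd k y' then W' (fst k x) y' * h y else 0)"
    unfolding det_sim_def sum_distrib_right
    by (subst sum.swap) (intro sum.cong, auto)
  also have "\<dots> = (\<Sum>y'\<in>Y'. W' (fst k x) y' * h (snd k y'))"
    using assms by (intro sum.cong) (auto simp: Pi_iff)
  finally show ?thesis .
qed

text \<open>Extensional function spaces make the set of encoder-decoder pairs finite, so containment
  becomes membership in a polytope. Forwards, each \<open>R i\<close> and \<open>T i\<close> is
  resolved into random maps; backwards, the pairs are enumerated and read as 0-1 channels.\<close>

lemma channel_contains_iff_mixture:
  assumes fin: "finite X" "finite X'" "finite Y" "finite Y'"
  shows "channel_contains X' Y' W' X Y W \<longleftrightarrow>
    (\<exists>\<gamma>\<in>prob_dists ((X \<rightarrow>\<^sub>E X') \<times> (Y' \<rightarrow>\<^sub>E Y)). \<forall>x\<in>X. \<forall>y\<in>Y.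
      W x y = (\<Sum>k\<in>(X \<rightarrow>\<^sub>E X') \<times> (Y' \<rightarrow>\<^sub>E Y). \<gamma> k * det_sim Y' W' k x y))"
    (is "_ \<longleftrightarrow> (\<exists>\<gamma>\<in>prob_dists ?D. ?mix \<gamma>)")
proof
  assume "channel_contains X' Y' W' X Y W"
  then obtain n :: nat and \<alpha> R T where \<alpha>: "\<alpha> \<in> prob_dists {1..n}"
    and RT: "\<And>i. i \<in> {1..n} \<Longrightarrow> R i \<in> DMC X X'" "\<And>i. i \<in> {1..n} \<Longrightarrow> T i \<in> DMC Y' Y"
    and W: "\<And>x y. x \<in> X \<Longrightarrow> y \<in> Y \<Longrightarrow> W x y =
        (\<Sum>i=1..n. \<alpha> i * channel_comp Y' (T i) (channel_comp X' W' (R i)) x y)"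
    unfolding channel_contains_def by blast
  \<comment> \<open>Given \<open>i\<close>, encoder and decoder are drawn independently;
    \<open>\<gamma>\<close> then averages over \<open>i\<close>.\<close>
  define \<pi> where "\<pi> i k = product_dist X (R i) (fst k) * product_dist Y' (T i) (snd k)" for i k
  define \<gamma> where "\<gamma> k = (\<Sum>i=1..n. \<alpha> i * \<pi> i k)" for k
  have P: "product_dist X (R i) \<in> prob_dists (X \<rightarrow>\<^sub>E X')"
    "product_dist Y' (T i) \<in> prob_dists (Y' \<rightarrow>\<^sub>E Y)" if "i \<in> {1..n}" for i
    using product_dist_prob_dists fin RT that by blast+
  have \<pi>: "\<pi> i \<in> prob_dists ?D" if "i \<in> {1..n}" for i
    unfolding \<pi>_def by (intro prob_dists_Times P that)
  have "(\<Sum>k\<in>?D. \<gamma> k) = (\<Sum>i=1..n. \<alpha> i * (\<Sum>k\<in>?D. \<pi> i k))"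
    unfolding \<gamma>_def sum_distrib_left by (rule sum.swap)
  also have "\<dots> = 1"
    using \<alpha> \<pi> by (simp add: prob_dists_def)
  moreover have "0 \<le> \<gamma> k" if "k \<in> ?D" for k
    unfolding \<gamma>_def using \<alpha> \<pi> that
    by (intro sum_nonneg mult_nonneg_nonneg) (auto simp: prob_dists_def)
  ultimately have "\<gamma> \<in> prob_dists ?D" by (simp add: prob_dists_def)
  moreover have "W x y = (\<Sum>k\<in>?D. \<gamma> k * det_sim Y' W' k x y)" if xy: "x \<in> X" "y \<in> Y" for x y
  proof -
    have "channel_comp Y' (T i) (channel_comp X' W' (R i)) x y =
        (\<Sum>k\<in>?D. \<pi> i k * det_sim Y' W' k x y)" if i: "i \<in> {1..n}" for i
    proof -
      have "(\<Sum>k\<in>?D. \<pi> i k * det_sim Y' W' k x y) =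
        (\<Sum>y'\<in>Y'. \<Sum>k\<in>?D. \<pi> i k * (W' (fst k x) y' * of_bool (snd k y' = y)))"
        unfolding det_sim_def sum_distrib_left by (rule sum.swap)
      \<comment> \<open>For fixed \<open>y'\<close> the summand is a factor in the encoder times a
        factor in the decoder. Independence splits the sum, and each factor depends on its random
        map at one point only, so marginals suffice.\<close>
      also have "\<dots> = (\<Sum>y'\<in>Y'. (\<Sum>r\<in>X \<rightarrow>\<^sub>E X'. product_dist X (R i) r * W' (r x) y') *
          (\<Sum>t\<in>Y' \<rightarrow>\<^sub>E Y. product_dist Y' (T i) t * of_bool (t y' = y)))"
        by (simp add: \<pi>_def sum.cartesian_product' sum_product mult_ac)
      also have "\<dots> = (\<Sum>y'\<in>Y'. (\<Sum>x'\<in>X'. R i x x' * W' x' y') * T i y' y)"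
      proof (intro sum.cong refl arg_cong2[where f = "(*)"])
        fix y' assume y': "y' \<in> Y'"
        show "(\<Sum>r\<in>X \<rightarrow>\<^sub>E X'. product_dist X (R i) r * W' (r x) y') = (\<Sum>x'\<in>X'. R i x x' * W' x' y')"
          using product_dist_marginal[OF fin(1,2) RT(1)[OF i] xy(1)] .
        show "(\<Sum>t\<in>Y' \<rightarrow>\<^sub>E Y. product_dist Y' (T i) t * of_bool (t y' = y)) = T i y' y"
          using product_dist_marginal[OF fin(4,3) RT(2)[OF i] y', of "\<lambda>z. of_bool (z = y)"] fin xy
          by (simp add: of_bool_def if_distrib cong: if_cong)
      qed
      finally show ?thesis by (simp add: channel_comp_def mult_ac)
    qed
    then have "W x y = (\<Sum>i=1..n. \<alpha> i * (\<Sum>k\<in>?D. \<pi> i k * det_sim Y' W' k x y))"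
      using W[OF xy] by simp
    also have "\<dots> = (\<Sum>k\<in>?D. \<gamma> k * det_sim Y' W' k x y)"
      unfolding \<gamma>_def sum_distrib_left sum_distrib_right
      by (subst sum.swap) (simp add: mult_ac)
    finally show ?thesis .
  qed
  ultimately show "\<exists>\<gamma>\<in>prob_dists ?D. ?mix \<gamma>" by blast
next
  assume "\<exists>\<gamma>\<in>prob_dists ?D. ?mix \<gamma>"
  then obtain \<gamma> where \<gamma>: "\<gamma> \<in> prob_dists ?D" and mix: "?mix \<gamma>" by blast
  have "finite ?D" using fin by (auto intro!: finite_PiE)
  then obtain n :: nat and b where n: "n \<ge> 1" and b: "bij_betw b {1..n} ?D"
    using prob_dists_enumeration[OF _ \<gamma>] by blast
  define R where "R i x x' = (of_bool (fst (b i) x = x') :: real)" for i x x'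
  define T where "T i y' y = (of_bool (snd (b i) y' = y) :: real)" for i y' y
  have bi: "fst (b i) \<in> X \<rightarrow> X'" "snd (b i) \<in> Y' \<rightarrow> Y" if "i \<in> {1..n}" for i
    using bij_betwE[OF b] that by (force simp: PiE_iff mem_Times_iff)+
  have "R i \<in> DMC X X'" "T i \<in> DMC Y' Y" if "i \<in> {1..n}" for i
    using bi[OF that] fin by (auto simp: DMC_def R_def T_def of_bool_def Pi_iff)
  moreover have "W x y = (\<Sum>i=1..n. (\<gamma> \<circ> b) i *
      channel_comp Y' (T i) (channel_comp X' W' (R i)) x y)" if xy: "x \<in> X" "y \<in> Y" for x y
  proof -
    have "channel_comp Y' (T i) (channel_comp X' W' (R i)) x y = det_sim Y' W' (b i) x y"
      if "i \<in> {1..n}" for i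
    proof -
      have "(\<Sum>x'\<in>X'. W' x' y' * R i x x') = W' (fst (b i) x) y'" for y'
        using bi(1)[OF that] xy fin by (auto simp: R_def of_bool_def if_distrib Pi_iff cong: if_cong)
      then show ?thesis
        by (simp add: channel_comp_def det_sim_def T_def mult.commute)
    qed
    then show ?thesis
      using mix xy sum.reindex_bij_betw[OF b, of "\<lambda>k. \<gamma> k * det_sim Y' W' k x y"] by simp
  qed
  ultimately show "channel_contains X' Y' W' X Y W"
    unfolding channel_contains_def using n prob_dists_reindex[OF b \<gamma>] by blast
qed

section \<open>Simulating strategies through the containing channel\<close>

text \<open>Renumbering lets any finite set index a strategy. The witness is chosen before
  \<open>u\<close>, \<open>l\<close> and \<open>W\<close>, so one strategy serves every coordinate
  of the payoff vector.\<close>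

lemma mixture_strategy:
  assumes "finite K" "p \<in> prob_dists K"
    and fg: "\<And>k. k \<in> K \<Longrightarrow> f k \<in> U \<rightarrow> X \<and> g k \<in> Y \<rightarrow> V"
  shows "\<exists>S\<in>brm_strategies U X Y V. \<forall>u l W.
    payoff u S (U, X, Y, V, l, W) = (\<Sum>k\<in>K. p k * (\<Sum>y\<in>Y. W (f k u) y * l (u, g k y)))"
proof -
  obtain n :: nat and b where n: "n \<ge> 1" and b: "bij_betw b {1..n} K"
    using prob_dists_enumeration[OF assms(1,2)] by blast
  let ?S = "(n, p \<circ> b, f \<circ> b, g \<circ> b)"
  show ?thesis
  proof (intro bexI[of _ ?S] allI)
    show "?S \<in> brm_strategies U X Y V"
      using n prob_dists_reindex[OF b assms(2)] fg bij_betwE[OF b] by (auto simp: brm_strategies_def)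
    show "payoff u ?S (U, X, Y, V, l, W) = (\<Sum>k\<in>K. p k * (\<Sum>y\<in>Y. W (f k u) y * l (u, g k y)))"
      for u l W
      using sum.reindex_bij_betw[OF b, of "\<lambda>k. p k * (\<Sum>y\<in>Y. W (f k u) y * l (u, g k y))"] by simp
  qed
qed

lemma payoff_ach_mono:
  fixes X :: "'x set" and X' :: "'x2 set" and Y :: "'y set" and Y' :: "'y2 set"
  assumes fin: "finite X" "finite X'" "finite Y" "finite Y'"
    and cont: "channel_contains X' Y' W' X Y W"
  shows "payoff_ach (U, X, Y, V, l, W) \<subseteq> payoff_ach (U, X', Y', V, l, W')"
proof
  fix v assume "v \<in> payoff_ach (U, X, Y, V, l, W)"
  then obtain n \<alpha> f g where S: "(n, \<alpha>, f, g) \<in> brm_strategies U X Y V"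
    and v: "v = (\<lambda>u\<in>U. payoff u (n, \<alpha>, f, g) (U, X, Y, V, l, W))"
    by auto
  let ?D = "(X \<rightarrow>\<^sub>E X') \<times> (Y' \<rightarrow>\<^sub>E Y)"
  obtain \<gamma> where \<gamma>: "\<gamma> \<in> prob_dists ?D"
    and mix: "\<And>x y. x \<in> X \<Longrightarrow> y \<in> Y \<Longrightarrow> W x y = (\<Sum>k\<in>?D. \<gamma> k * det_sim Y' W' k x y)"
    using cont unfolding channel_contains_iff_mixture[OF fin] by blast
  \<comment> \<open>The simulation draws a component \<open>i\<close> of the given strategy and,
    independently, a pair from \<open>\<gamma>\<close>. The pair's encoder is applied after
    \<open>f i\<close>, its decoder before \<open>g i\<close>.\<close>
  define p where "p k = \<alpha> (fst k) * \<gamma> (snd k)" for k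
  define f' where "f' k = fst (snd k) \<circ> f (fst k)" for k :: "nat \<times> ('x \<Rightarrow> 'x2) \<times> ('y2 \<Rightarrow> 'y)"
  define g' where "g' k = g (fst k) \<circ> snd (snd k)" for k :: "nat \<times> ('x \<Rightarrow> 'x2) \<times> ('y2 \<Rightarrow> 'y)"
  have \<alpha>: "\<alpha> \<in> prob_dists {1..n}" and fg: "\<And>i. i \<in> {1..n} \<Longrightarrow> f i \<in> U \<rightarrow> X \<and> g i \<in> Y \<rightarrow> V"
    using S by (auto simp: brm_strategies_def)
  have f'g': "f' k \<in> U \<rightarrow> X' \<and> g' k \<in> Y' \<rightarrow> V" if "k \<in> {1..n} \<times> ?D" for k
    using fg[of "fst k"] that by (fastforce simp: f'_def g'_def PiE_iff)
  have finK: "finite ({1..n} \<times> ?D)" using fin by (auto intro!: finite_PiE)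
  have p: "p \<in> prob_dists ({1..n} \<times> ?D)"
    unfolding p_def using prob_dists_Times[OF \<alpha> \<gamma>] .
  obtain S' where S': "S' \<in> brm_strategies U X' Y' V"
    and pay: "\<And>u l W. payoff u S' (U, X', Y', V, l, W) =
      (\<Sum>k\<in>{1..n} \<times> ?D. p k * (\<Sum>y\<in>Y'. W (f' k u) y * l (u, g' k y)))"
    using mixture_strategy[where f = f' and g = g', OF finK p f'g'] by blast
  have "payoff u S' (U, X', Y', V, l, W') = payoff u (n, \<alpha>, f, g) (U, X, Y, V, l, W)"
    if u: "u \<in> U" for u
  proof -
    \<comment> \<open>The payoff is linear in the channel, so the mixture for \<open>W\<close> can
      be pulled out of it.\<close>
    have "(\<Sum>y\<in>Y. W (f i u) y * l (u, g i y)) =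
        (\<Sum>k\<in>?D. \<gamma> k * (\<Sum>y'\<in>Y'. W' (fst k (f i u)) y' * l (u, g i (snd k y'))))"
      if i: "i \<in> {1..n}" for i
    proof -
      have "(\<Sum>y\<in>Y. W (f i u) y * l (u, g i y)) =
        (\<Sum>y\<in>Y. \<Sum>k\<in>?D. \<gamma> k * (det_sim Y' W' k (f i u) y * l (u, g i y)))"
        using mix[of "f i u"] fg[OF i] u
        by (intro sum.cong) (auto simp: sum_distrib_right mult.assoc Pi_iff)
      also have "\<dots> = (\<Sum>k\<in>?D. \<gamma> k * (\<Sum>y\<in>Y. det_sim Y' W' k (f i u) y * l (u, g i y)))"
        unfolding sum_distrib_left by (rule sum.swap)
      also have "\<dots> = (\<Sum>k\<in>?D. \<gamma> k * (\<Sum>y'\<in>Y'. W' (fst k (f i u)) y' * l (u, g i (snd k y'))))"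
        using fin(3) by (intro sum.cong refl arg_cong2[where f = "(*)"] sum_det_sim) auto
      finally show ?thesis .
    qed
    then show ?thesis
      unfolding pay
      by (simp add: p_def f'_def g'_def sum.cartesian_product' sum_distrib_left mult.assoc)
  qed
  then have "v = (\<lambda>u\<in>U. payoff u S' (U, X', Y', V, l, W'))"
    unfolding v by (intro restrict_ext) simp
  then show "v \<in> payoff_ach (U, X', Y', V, l, W')" using S' unfolding payoff_ach.simps by blast
qed

section \<open>Bounds on payoffs and monotonicity of the optimum\<close>

lemma brm_strategies_nonempty:
  assumes "X \<noteq> {}" "V \<noteq> {}"
  shows "brm_strategies U X Y V \<noteq> {}"
proof -
  obtain x v where "x \<in> X" "v \<in> V" using assms by auto
  then have "(1, \<lambda>_. 1, \<lambda>_ _. x, \<lambda>_ _. v) \<in> brm_strategies U X Y V"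
    by (auto simp: brm_strategies_def prob_dists_def)
  then show ?thesis by blast
qed

lemma prob_dists_average_le:
  assumes "p \<in> prob_dists K" "\<And>k. k \<in> K \<Longrightarrow> h k \<le> M"
  shows "(\<Sum>k\<in>K. p k * h k) \<le> M"
proof -
  have "(\<Sum>k\<in>K. p k * h k) \<le> (\<Sum>k\<in>K. p k * M)"
    using assms by (intro sum_mono mult_left_mono) (auto simp: prob_dists_def)
  also have "\<dots> = M" using assms(1) by (simp add: prob_dists_def flip: sum_distrib_right)
  finally show ?thesis .
qed

text \<open>A payoff is an average over \<open>i\<close> of averages over \<open>y\<close> of values
  of \<open>l\<close>.\<close>

lemma payoff_le:
  assumes W: "W \<in> DMC X Y" and S: "S \<in> brm_strategies U X Y V" and u: "u \<in> U"
    and l: "\<And>v. v \<in> V \<Longrightarrow> l (u, v) \<le> M"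
  shows "payoff u S (U, X, Y, V, l, W) \<le> M"
proof (cases S)
  case (fields n \<alpha> f g)
  then have \<alpha>: "\<alpha> \<in> prob_dists {1..n}" and fg: "\<And>i. i \<in> {1..n} \<Longrightarrow> f i \<in> U \<rightarrow> X \<and> g i \<in> Y \<rightarrow> V"
    using S by (auto simp: brm_strategies_def)
  have "(\<Sum>y\<in>Y. W (f i u) y * l (u, g i y)) \<le> M" if "i \<in> {1..n}" for i
  proof (rule prob_dists_average_le)
    show "W (f i u) \<in> prob_dists Y"
      using W fg[OF that] u by (auto simp: DMC_def prob_dists_def)
    show "l (u, g i y) \<le> M" if "y \<in> Y" for y
      using fg[OF \<open>i \<in> {1..n}\<close>] that l by auto
  qed
  then show ?thesis
    unfolding fields payoff.simps using \<alpha> by (rule prob_dists_average_le[rotated])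
qed

text \<open>Makes the real supremum in \<open>payoff_opt\<close> usable. The total absolute value of
  \<open>l\<close> bounds the payoff of every strategy.\<close>

lemma bdd_above_average_payoff:
  assumes "W \<in> DMC X Y" "finite U" "finite V"
  shows "bdd_above ((\<lambda>S. 1 / real (card U) * (\<Sum>u\<in>U. payoff u S (U, X, Y, V, l, W))) `
    brm_strategies U X Y V)"
proof (rule bdd_aboveI2)
  fix S assume S: "S \<in> brm_strategies U X Y V"
  have "payoff u S (U, X, Y, V, l, W) \<le> (\<Sum>a\<in>U \<times> V. \<bar>l a\<bar>)" if "u \<in> U" for u
  proof (rule payoff_le[OF assms(1) S that])
    fix v assume "v \<in> V"
    then have "\<bar>l (u, v)\<bar> \<le> (\<Sum>a\<in>U \<times> V. \<bar>l a\<bar>)"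
      using assms that by (intro member_le_sum[where f = "\<lambda>a. \<bar>l a\<bar>"]) auto
    then show "l (u, v) \<le> (\<Sum>a\<in>U \<times> V. \<bar>l a\<bar>)" by linarith
  qed
  then have "(\<Sum>u\<in>U. payoff u S (U, X, Y, V, l, W)) \<le> (\<Sum>u\<in>U. \<Sum>a\<in>U \<times> V. \<bar>l a\<bar>)"
    by (rule sum_mono)
  then show "1 / real (card U) * (\<Sum>u\<in>U. payoff u S (U, X, Y, V, l, W)) \<le>
      1 / real (card U) * (\<Sum>u\<in>U. \<Sum>a\<in>U \<times> V. \<bar>l a\<bar>)"
    by (intro mult_left_mono) auto
qed

text \<open>The average depends on a strategy only through its payoff vector, so a larger region has
  at least as large an optimum.\<close>

lemma payoff_opt_mono:
  assumes "X \<noteq> {}" "W' \<in> DMC X' Y'" "finite U" "finite V" "V \<noteq> {}"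
    and sub: "payoff_ach (U, X, Y, V, l, W) \<subseteq> payoff_ach (U, X', Y', V, l, W')"
  shows "payoff_opt (U, X, Y, V, l, W) \<le> payoff_opt (U, X', Y', V, l, W')"
  unfolding payoff_opt.simps
proof (rule cSUP_mono[OF brm_strategies_nonempty bdd_above_average_payoff])
  fix S assume "S \<in> brm_strategies U X Y V"
  then have "(\<lambda>u\<in>U. payoff u S (U, X, Y, V, l, W)) \<in> payoff_ach (U, X', Y', V, l, W')"
    using sub unfolding payoff_ach.simps by blast
  then obtain S' where S': "S' \<in> brm_strategies U X' Y' V"
    and eq: "(\<lambda>u\<in>U. payoff u S (U, X, Y, V, l, W)) = (\<lambda>u\<in>U. payoff u S' (U, X', Y', V, l, W'))"
    unfolding payoff_ach.simps by blast
  have "payoff u S (U, X, Y, V, l, W) = payoff u S' (U, X', Y', V, l, W')" if "u \<in> U" for u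
    using fun_cong[OF eq, of u] that by simp
  then show "\<exists>S'\<in>brm_strategies U X' Y' V.
      1 / real (card U) * (\<Sum>u\<in>U. payoff u S (U, X, Y, V, l, W))
      \<le> 1 / real (card U) * (\<Sum>u\<in>U. payoff u S' (U, X', Y', V, l, W'))"
    using S' by (intro bexI[of _ S']) simp_all
qed (use assms in auto)

section \<open>A normalized positive game that detects non-containment\<close>

text \<open>Each row sums to 1, so the shift contributes \<open>M\<close> per input whatever the
  decoder \<open>s\<close> is. Shifting and scaling thus act identically on all totals being
  compared.\<close>

lemma sum_affine_payoff:
  fixes w :: "'a \<Rightarrow> 'b \<Rightarrow> real"
  assumes "\<And>x. x \<in> X \<Longrightarrow> (\<Sum>z\<in>B. w x z) = 1"
  shows "(\<Sum>x\<in>X. \<Sum>z\<in>B. w x z * ((l (x, s z) + M) / Z)) =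
    ((\<Sum>x\<in>X. \<Sum>z\<in>B. w x z * l (x, s z)) + M * card X) / Z"
  using assms
  by (simp add: distrib_left sum.distrib add_divide_distrib
      flip: sum_divide_distrib sum_distrib_left sum_distrib_right)

text \<open>The functional separating \<open>W\<close> from the hull is read as a payoff function
  with inputs as questions and outputs as answers.\<close>

lemma separating_payoff_exists:
  assumes fin: "finite X" "X \<noteq> {}" "finite X'" "X' \<noteq> {}"
    "finite Y" "Y \<noteq> {}" "finite Y'"
    and W: "W \<in> DMC X Y" "W' \<in> DMC X' Y'"
    and not: "\<not> channel_contains X' Y' W' X Y W"
  obtains l where "l \<in> prob_dists (X \<times> Y)"
    "\<And>r t. r \<in> X \<rightarrow>\<^sub>E X' \<Longrightarrow> t \<in> Y' \<rightarrow>\<^sub>E Y \<Longrightarrow>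
      (\<Sum>x\<in>X. \<Sum>y'\<in>Y'. W' (r x) y' * l (x, t y')) < (\<Sum>x\<in>X. \<Sum>y\<in>Y. W x y * l (x, y))"
proof -
  let ?D = "(X \<rightarrow>\<^sub>E X') \<times> (Y' \<rightarrow>\<^sub>E Y)"
  have "finite ?D" "?D \<noteq> {}"
    using fin by (auto intro!: finite_PiE simp: PiE_eq_empty_iff)
  moreover have "finite (X \<times> Y)" using fin by simp
  moreover have "\<not> (\<exists>p\<in>prob_dists ?D. \<forall>a\<in>X \<times> Y.
      case_prod W a = (\<Sum>k\<in>?D. p k * case_prod (det_sim Y' W' k) a))"
    using not unfolding channel_contains_iff_mixture[OF fin(1,3,5,7)] by auto
  ultimately have "\<exists>l. \<forall>k\<in>?D.
      (\<Sum>a\<in>X \<times> Y. l a * case_prod (det_sim Y' W' k) a) < (\<Sum>a\<in>X \<times> Y. l a * case_prod W a)"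
    by (intro convex_separation)
  then obtain l where l: "\<And>k. k \<in> ?D \<Longrightarrow>
      (\<Sum>a\<in>X \<times> Y. l a * case_prod (det_sim Y' W' k) a) < (\<Sum>a\<in>X \<times> Y. l a * case_prod W a)"
    by blast
  \<comment> \<open>The extra 1 makes the shifted values strictly positive, hence also the
    normalizing constant \<open>Z\<close>.\<close>
  define M where "M = 1 + (\<Sum>a\<in>X \<times> Y. \<bar>l a\<bar>)"
  have M: "l a + M > 0" if "a \<in> X \<times> Y" for a
    using member_le_sum[OF that, of "\<lambda>a. \<bar>l a\<bar>"] fin by (auto simp: M_def)
  define Z where "Z = (\<Sum>a\<in>X \<times> Y. l a + M)"
  have Z: "Z > 0" unfolding Z_def using fin M by (intro sum_pos) auto
  define l' where "l' a = (l a + M) / Z" for a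
  have "(\<Sum>a\<in>X \<times> Y. l' a) = 1"
    unfolding l'_def sum_divide_distrib[symmetric] Z_def[symmetric] using Z by simp
  moreover have "0 \<le> l' a" if "a \<in> X \<times> Y" for a
    using M[OF that] Z by (simp add: l'_def)
  ultimately have "l' \<in> prob_dists (X \<times> Y)" by (auto simp: prob_dists_def)
  moreover have "(\<Sum>x\<in>X. \<Sum>y'\<in>Y'. W' (r x) y' * l' (x, t y')) < (\<Sum>x\<in>X. \<Sum>y\<in>Y. W x y * l' (x, y))"
    if rt: "r \<in> X \<rightarrow>\<^sub>E X'" "t \<in> Y' \<rightarrow>\<^sub>E Y" for r t
  proof -
    \<comment> \<open>The total payoff of the deterministic pair is the functional evaluated at the
      corresponding vertex of the hull.\<close>
    have "(\<Sum>x\<in>X. \<Sum>y'\<in>Y'. W' (r x) y' * l (x, t y')) =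
        (\<Sum>x\<in>X. \<Sum>y\<in>Y. det_sim Y' W' (r, t) x y * l (x, y))"
      using rt by (subst sum_det_sim[OF fin(5)]) auto
    also have "\<dots> = (\<Sum>a\<in>X \<times> Y. l a * case_prod (det_sim Y' W' (r, t)) a)"
      by (simp add: sum.cartesian_product' mult.commute)
    also have "\<dots> < (\<Sum>x\<in>X. \<Sum>y\<in>Y. W x y * l (x, y))"
      using l[of "(r, t)"] rt by (simp add: sum.cartesian_product' mult.commute)
    finally have "(\<Sum>x\<in>X. \<Sum>y'\<in>Y'. W' (r x) y' * l (x, t y')) < (\<Sum>x\<in>X. \<Sum>y\<in>Y. W x y * l (x, y))" .
    moreover have "(\<Sum>y'\<in>Y'. W' (r x) y') = 1" "(\<Sum>y\<in>Y. W x y) = 1" if "x \<in> X" for x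
      using W rt that by (auto simp: DMC_def PiE_iff)
    ultimately show ?thesis
      using Z sum_affine_payoff[of X "\<lambda>x. W' (r x)" Y' l t M Z]
        sum_affine_payoff[of X W Y l "\<lambda>y. y" M Z]
      by (simp add: l'_def divide_strict_right_mono)
  qed
  ultimately show ?thesis using that by blast
qed

lemma payoff_opt_imp_contains:
  fixes X :: "'x set" and X' :: "'x2 set" and Y :: "'y set" and Y' :: "'y2 set"
  assumes fin: "finite X" "X \<noteq> {}" "finite X'" "X' \<noteq> {}"
    "finite Y" "Y \<noteq> {}" "finite Y'"
    and W: "W \<in> DMC X Y" "W' \<in> DMC X' Y'"
    and opt: "\<And>(U :: 'u::infinite set) (V :: 'v::infinite set) l.
      l \<in> prob_dists (U \<times> V) \<Longrightarrow> finite U \<Longrightarrow> U \<noteq> {} \<Longrightarrow> finite V \<Longrightarrow> V \<noteq> {} \<Longrightarrow>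
      payoff_opt (U, X, Y, V, l, W) \<le> payoff_opt (U, X', Y', V, l, W')"
  shows "channel_contains X' Y' W' X Y W"
proof (rule ccontr)
  assume not: "\<not> channel_contains X' Y' W' X Y W"
  obtain l where l: "l \<in> prob_dists (X \<times> Y)"
    and less: "\<And>r t. r \<in> X \<rightarrow>\<^sub>E X' \<Longrightarrow> t \<in> Y' \<rightarrow>\<^sub>E Y \<Longrightarrow>
      (\<Sum>x\<in>X. \<Sum>y'\<in>Y'. W' (r x) y' * l (x, t y')) < (\<Sum>x\<in>X. \<Sum>y\<in>Y. W x y * l (x, y))"
    by (rule separating_payoff_exists[OF fin W not]) blast
  \<comment> \<open>The game must be played on subsets of \<open>'u\<close> and \<open>'v\<close>;
    these types are infinite, so they contain copies of \<open>X\<close> and \<open>Y\<close>, to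
    which \<open>l\<close> is transported.\<close>
  obtain h :: "'x \<Rightarrow> 'u" where h: "inj_on h X"
    using arb_inj_on_finite_infinite fin(1) by blast
  obtain j :: "'y \<Rightarrow> 'v" where j: "inj_on j Y"
    using arb_inj_on_finite_infinite fin(5) by blast
  define U where "U = h ` X"
  define V where "V = j ` Y"
  define h' where "h' = the_inv_into X h"
  define j' where "j' = the_inv_into Y j"
  have inv: "h' (h x) = x" if "x \<in> X" for x
    using that h by (simp add: h'_def the_inv_into_f_f)
  have inv': "j' (j y) = y" if "y \<in> Y" for y
    using that j by (simp add: j'_def the_inv_into_f_f)
  define L where "L a = l (h' (fst a), j' (snd a))" for a
  have sumU: "(\<Sum>u\<in>U. k u) = (\<Sum>x\<in>X. k (h x))" for k :: "'u \<Rightarrow> real"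
    unfolding U_def using h by (simp add: sum.reindex)
  have sumV: "(\<Sum>v\<in>V. k v) = (\<Sum>y\<in>Y. k (j y))" for k :: "'v \<Rightarrow> real"
    unfolding V_def using j by (simp add: sum.reindex)
  have UV: "finite U" "U \<noteq> {}" "finite V" "V \<noteq> {}"
    using fin by (auto simp: U_def V_def)
  have "L \<in> prob_dists (U \<times> V)"
    using l unfolding prob_dists_def
    by (auto simp: sum.cartesian_product' sumU sumV L_def inv inv') (auto simp: U_def V_def inv inv')
  then have le: "payoff_opt (U, X, Y, V, L, W) \<le> payoff_opt (U, X', Y', V, L, W')"
    using opt UV by blast
  \<comment> \<open>The total payoff of a deterministic pair over \<open>W'\<close>. Every
    strategy's total is a weighted average of such values, hence at most their maximum.\<close>
  define s where "s k = (\<Sum>x\<in>X. \<Sum>y'\<in>Y'. W' (fst k x) y' * l (x, snd k y'))" for k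
  let ?D = "(X \<rightarrow>\<^sub>E X') \<times> (Y' \<rightarrow>\<^sub>E Y)"
  have D: "finite ?D" "?D \<noteq> {}"
    using fin by (auto intro!: finite_PiE simp: PiE_eq_empty_iff)
  have avg: "(\<Sum>u\<in>U. payoff u S (U, X', Y', V, L, W')) \<le> Max (s ` ?D)"
    if S: "S \<in> brm_strategies U X' Y' V" for S
  proof (cases S)
    case (fields n \<alpha> f g)
    then have \<alpha>: "\<alpha> \<in> prob_dists {1..n}"
      and fg: "\<And>i. i \<in> {1..n} \<Longrightarrow> f i \<in> U \<rightarrow> X' \<and> g i \<in> Y' \<rightarrow> V"
      using S by (auto simp: brm_strategies_def)
    \<comment> \<open>Translating back to \<open>X\<close> and \<open>Y\<close> and restricting to
      the carriers places each component of the strategy in the finite set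
      \<open>?D\<close>.\<close>
    define k where "k i = (\<lambda>x\<in>X. f i (h x), \<lambda>y'\<in>Y'. j' (g i y'))" for i
    have kD: "k i \<in> ?D" if "i \<in> {1..n}" for i
      using fg[OF that] inv' by (auto simp: k_def U_def V_def Pi_iff)
    have "(\<Sum>u\<in>U. payoff u S (U, X', Y', V, L, W')) =
        (\<Sum>i=1..n. \<Sum>x\<in>X. \<alpha> i * (\<Sum>y'\<in>Y'. W' (f i (h x)) y' * L (h x, g i y')))"
      unfolding fields payoff.simps sumU by (rule sum.swap)
    also have "\<dots> = (\<Sum>i=1..n. \<alpha> i * s (k i))"
      by (simp add: s_def k_def L_def inv sum_distrib_left)
    also have "\<dots> \<le> Max (s ` ?D)"
      using kD D by (intro prob_dists_average_le[OF \<alpha>] Max_ge) auto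
    finally show ?thesis .
  qed
  have "payoff_opt (U, X', Y', V, L, W') \<le> 1 / real (card U) * Max (s ` ?D)"
    unfolding payoff_opt.simps
    using avg by (intro cSUP_least brm_strategies_nonempty[OF fin(4) UV(4)] mult_left_mono) auto
  also have "\<dots> < 1 / real (card U) * (\<Sum>x\<in>X. \<Sum>y\<in>Y. W x y * l (x, y))"
  proof -
    \<comment> \<open>Since \<open>?D\<close> is finite, the strict inequality for each pair
      survives taking the maximum.\<close>
    have "Max (s ` ?D) < (\<Sum>x\<in>X. \<Sum>y\<in>Y. W x y * l (x, y))"
      using D less by (subst Max_less_iff) (auto simp: s_def)
    moreover have "0 < card U" using UV by (simp add: card_gt_0_iff)
    ultimately show ?thesis by (intro mult_strict_left_mono) auto
  qed
  also have "\<dots> \<le> payoff_opt (U, X, Y, V, L, W)"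
  proof -
    \<comment> \<open>The identity strategy up to relabelling: \<open>h'\<close> recovers the input
      from its copy and \<open>j\<close> copies the output. Its total is the functional evaluated at
      \<open>W\<close>.\<close>
    let ?S = "(1, \<lambda>_. 1, \<lambda>_. h', \<lambda>_. j) :: ('u, 'x, 'y, 'v) brm_strategy"
    have mem: "?S \<in> brm_strategies U X Y V"
      by (auto simp: brm_strategies_def prob_dists_def U_def V_def inv)
    have eq: "(\<Sum>u\<in>U. payoff u ?S (U, X, Y, V, L, W)) = (\<Sum>x\<in>X. \<Sum>y\<in>Y. W x y * l (x, y))"
      unfolding sumU by (simp add: L_def inv inv')
    show ?thesis
      using cSUP_upper[OF mem bdd_above_average_payoff[OF W(1) UV(1,3)], of L]
      unfolding payoff_opt.simps eq .
  qed
  finally show False using le by simp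
qed

section \<open>Equivalence of the five conditions\<close>

theorem theorem2:
  fixes X :: "'x set" and X' :: "'x2 set" and Y :: "'y set" and Y' :: "'y2 set"
    and W :: "'x \<Rightarrow> 'y \<Rightarrow> real" and W' :: "'x2 \<Rightarrow> 'y2 \<Rightarrow> real"
  assumes "finite X" "X \<noteq> {}" "finite X'" "X' \<noteq> {}"
    and "finite Y" "Y \<noteq> {}" "finite Y'" "Y' \<noteq> {}"
    and "W \<in> DMC X Y" and "W' \<in> DMC X' Y'"
  shows
    "(channel_contains X' Y' W' X Y W \<longleftrightarrow>
      (\<forall>(U :: 'u::infinite set) (V :: 'v::infinite set) (l :: 'u \<times> 'v \<Rightarrow> real).
        finite U \<and> U \<noteq> {} \<and> finite V \<and> V \<noteq> {} \<longrightarrow>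
        payoff_ach (U, X, Y, V, l, W) \<subseteq> payoff_ach (U, X', Y', V, l, W'))) \<and>
    (channel_contains X' Y' W' X Y W \<longleftrightarrow>
      (\<forall>(U :: 'u set) (V :: 'v set) (l :: 'u \<times> 'v \<Rightarrow> real).
        finite U \<and> U \<noteq> {} \<and> finite V \<and> V \<noteq> {} \<longrightarrow>
        payoff_opt (U, X, Y, V, l, W) \<le> payoff_opt (U, X', Y', V, l, W'))) \<and>
    (channel_contains X' Y' W' X Y W \<longleftrightarrow>
      (\<forall>(U :: 'u set) (V :: 'v set). \<forall>l \<in> prob_dists (U \<times> V).
        finite U \<and> U \<noteq> {} \<and> finite V \<and> V \<noteq> {} \<longrightarrow>
        payoff_ach (U, X, Y, V, l, W) \<subseteq> payoff_ach (U, X', Y', V, l, W'))) \<and>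
    (channel_contains X' Y' W' X Y W \<longleftrightarrow>
      (\<forall>(U :: 'u set) (V :: 'v set). \<forall>l \<in> prob_dists (U \<times> V).
        finite U \<and> U \<noteq> {} \<and> finite V \<and> V \<noteq> {} \<longrightarrow>
        payoff_opt (U, X, Y, V, l, W) \<le> payoff_opt (U, X', Y', V, l, W')))"
proof -
  let ?a = "channel_contains X' Y' W' X Y W"
  let ?fin = "\<lambda>(U :: 'u set) (V :: 'v set). finite U \<and> U \<noteq> {} \<and> finite V \<and> V \<noteq> {}"
  let ?b = "\<lambda>(U :: 'u set) (V :: 'v set) l.
    payoff_ach (U, X, Y, V, l, W) \<subseteq> payoff_ach (U, X', Y', V, l, W')"
  let ?c = "\<lambda>(U :: 'u set) (V :: 'v set) l.
    payoff_opt (U, X, Y, V, l, W) \<le> payoff_opt (U, X', Y', V, l, W')"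
  \<comment> \<open>\<open>ab\<close> and \<open>bc\<close> hold game by game, so they apply to all
    payoff functions and to normalized ones alike. \<open>ea\<close> starts from the weakest
    condition and closes every cycle.\<close>
  have ab: "?a \<Longrightarrow> ?b U V l" for U V l
    using payoff_ach_mono assms(1,3,5,7) by blast
  have bc: "?fin U V \<Longrightarrow> ?b U V l \<Longrightarrow> ?c U V l" for U V l
    using payoff_opt_mono[OF assms(2,10)] by blast
  have ea: "(\<And>U V l. l \<in> prob_dists (U \<times> V) \<Longrightarrow> ?fin U V \<Longrightarrow> ?c U V l) \<Longrightarrow> ?a"
    by (rule payoff_opt_imp_contains[where 'u = 'u and 'v = 'v]) (use assms in simp_all)
  have "?a \<longleftrightarrow> (\<forall>U V l. ?fin U V \<longrightarrow> ?b U V l)" "?a \<longleftrightarrow> (\<forall>U V l. ?fin U V \<longrightarrow> ?c U V l)"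
    "?a \<longleftrightarrow> (\<forall>U V. \<forall>l\<in>prob_dists (U \<times> V). ?fin U V \<longrightarrow> ?b U V l)"
    "?a \<longleftrightarrow> (\<forall>U V. \<forall>l\<in>prob_dists (U \<times> V). ?fin U V \<longrightarrow> ?c U V l)"
    using ab bc ea by meson+
  then show ?thesis by (intro conjI)
qed

end
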